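(* Let $q$ be a prime power and let $n\geq1$ and $0\leq k\leq n$ be integers. If $E\subseteq\mathbb{F}_q^n$ and $\mathcal{A}\subseteq A(k,n)$, then $$\left|I(E,\mathcal{A})-\frac{|E||\mathcal{A}|}{q^{n-k}}\right|\leq\left(q^{k(n-k)}|E||\mathcal{A}|\right)^{\frac12}\left(\frac{\binom{n-1}{k}_q\left(1-q^{-n}|E|\right)}{q^{k(n-k-1)}}\right)^{\frac12},$$ where the fraction inside the last brackets is bounded above by $1+o(1)$ (as $q\to\infty$ with $n,k$ fixed, uniformly in $E$).
   Context: $\mathbb{F}_q$ is the finite field with $q$ elements and $|X|$ is the cardinality of a finite set $X$. $A(k,n)$ is the set of all $k$-dimensional affine subspaces ($k$-planes) of $\mathbb{F}_q^n$, i.e. all cosets $x+V$ with $x\in\mathbb{F}_q^n$ and $V$ a $k$-dimensional linear subspace. The incidence function is $I(E,\mathcal{A})=|\{(p,A)\in E\times\mathcal{A}: p\in A\}|$. The Gaussian binomial coefficient is $$\binom{n}{k}_q=\frac{(q^n-1)(q^n-q)\cdots(q^n-q^{k-1})}{(q^k-1)(q^k-q)\cdots(q^k-q^{k-1})}\quad\text{if }0\leq k\leq n,$$ (equal to $1$ for $k=0$), and $\binom{n}{k}_q=0$ if $k>n$. *)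

theory Defs
  imports "HOL-Analysis.Analysis" "HOL-Number_Theory.Number_Theory" "HOL-Library.Landau_Symbols"
begin

definition gauss_binomial :: "nat \<Rightarrow> nat \<Rightarrow> nat \<Rightarrow> real" where
  "gauss_binomial q n k =
     (if k \<le> n
      then (\<Prod>i<k. real q ^ n - real q ^ i) / (\<Prod>i<k. real q ^ k - real q ^ i)
      else 0)"

definition affine_planes :: "nat \<Rightarrow> (('a::field) ^ 'n) set set" where
  "affine_planes k = {(\<lambda>v. x + v) ` V |x V. vec.subspace V \<and> vec.dim V = k}"

definition incidences :: "'p set \<Rightarrow> 'p set set \<Rightarrow> nat" where
  "incidences E \<A> = card {(p, A). p \<in> E \<and> A \<in> \<A> \<and> p \<in> A}"

text \<open>
  The fraction inside the last brackets of the bound. It depends on the point set only through its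
  cardinality \<open>m\<close>, so an estimate for all \<open>m \<le> q ^ n\<close> is an estimate uniform in the point set, and
  the limit \<open>q \<rightarrow> \<infinity>\<close> can be taken although each field is a separate type.
  The exponent \<open>k (n - k - 1)\<close> equals \<open>- n\<close> when \<open>k = n\<close>, so it is taken in the integers.
\<close>
definition bound_fraction :: "nat \<Rightarrow> nat \<Rightarrow> nat \<Rightarrow> nat \<Rightarrow> real" where
  "bound_fraction q n k m =
     gauss_binomial q (n - 1) k * (1 - real q powi (- int n) * real m)
       / real q powi (int k * (int n - int k - 1))"

end

theory Submission
  imports Defs "HOL-Real_Asymp.Real_Asymp"
begin

text \<open>
  By Cauchy--Schwarz, the square of the deviation \<open>I(E, \<A>) - |E| |\<A>| / q^(n - k)\<close> is at most
  \<open>|\<A>|\<close> times the sum of \<open>(|E \<inter> A| - |E| / q^(n - k))\<^sup>2\<close> over all \<open>k\<close>-planes \<open>A\<close>. That second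
  moment can be computed exactly, because the number of \<open>k\<close>-planes through two points depends only
  on whether the points coincide: it counts the \<open>k\<close>-dimensional subspaces containing a given
  linearly independent set with no or one element. Such subspaces are counted through their
  ordered bases extending the given set.
\<close>

section \<open>Subspaces of a vector space over a finite field\<close>

text \<open>Each vector of the larger span is \<open>c *s x + v\<close> for exactly one pair
  \<open>(c, v)\<close>: two different coefficients of \<open>x\<close> would leave a nonzero
  multiple of \<open>x\<close> in \<open>vec.span S\<close>, and dividing by the scalar would put
  \<open>x\<close> there too.\<close>

lemma card_span_insert:
  fixes x :: "'a::{field,finite} ^ 'n::finite"
  assumes "x \<notin> vec.span S"
  shows "card (vec.span (insert x S)) = CARD('a) * card (vec.span S)"
proof -
  have "bij_betw (\<lambda>(c, v). c *s x + v) (UNIV \<times> vec.span S) (vec.span (insert x S))"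
    unfolding bij_betw_def
  proof
    show "inj_on (\<lambda>(c, v). c *s x + v) (UNIV \<times> vec.span S)"
    proof (rule inj_onI, clarify)
      fix c d v w
      assume v: "v \<in> vec.span S" and w: "w \<in> vec.span S" and eq: "c *s x + v = d *s x + w"
      have "(c - d) *s x = w - v"
        using eq by (simp add: vec.scale_left_diff_distrib algebra_simps)
      then have *: "(c - d) *s x \<in> vec.span S" using v w vec.span_diff by metis
      have "c = d"
      proof (rule ccontr)
        assume "c \<noteq> d"
        then have "x = inverse (c - d) *s ((c - d) *s x)"
          unfolding vec.scale_scale by simp
        then show False using vec.span_scale[OF *] assms by metis
      qed
      then show "c = d \<and> v = w" using eq by simp
    qed
    show "(\<lambda>(c, v). c *s x + v) ` (UNIV \<times> vec.span S) = vec.span (insert x S)"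
    proof (intro Set.set_eqI iffI)
      fix y assume "y \<in> vec.span (insert x S)"
      then obtain c where "y - c *s x \<in> vec.span S" by (auto simp: vec.span_insert)
      then show "y \<in> (\<lambda>(c, v). c *s x + v) ` (UNIV \<times> vec.span S)"
        by (intro image_eqI[where x = "(c, y - c *s x)"]) auto
    next
      fix y assume "y \<in> (\<lambda>(c, v). c *s x + v) ` (UNIV \<times> vec.span S)"
      then obtain c v where "v \<in> vec.span S" "y = c *s x + v" by auto
      then show "y \<in> vec.span (insert x S)"
        unfolding vec.span_insert by (intro CollectI exI[where x = c]) simp
    qed
  qed
  then have "card (UNIV \<times> vec.span S :: ('a \<times> _) set) = card (vec.span (insert x S))"
    by (rule bij_betw_same_card)
  then show ?thesis by (simp add: card_cartesian_product)
qed

lemma card_span_independent: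
  fixes S :: "('a::{field,finite} ^ 'n::finite) set"
  assumes "vec.independent S"
  shows "card (vec.span S) = CARD('a) ^ card S"
proof -
  have "finite S" by simp
  then show ?thesis using assms
  proof (induction S rule: finite_induct)
    case (insert x F)
    then show ?case by (simp add: vec.independent_insert card_span_insert)
  qed simp
qed

lemma card_subspace:
  fixes V :: "('a::{field,finite} ^ 'n::finite) set"
  assumes "vec.subspace V"
  shows "card V = CARD('a) ^ vec.dim V"
proof -
  obtain B where B: "B \<subseteq> V" "vec.independent B" "V \<subseteq> vec.span B" "card B = vec.dim V"
    using vec.basis_exists by blast
  then have "vec.span B = V" using assms vec.span_minimal by blast
  then show ?thesis using card_span_independent[OF B(2)] B(4) by simp
qed

text \<open>Lists fix an order, so the vectors can be counted one at a time. Distinct entries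
  outside \<open>Z\<close> make \<open>set xs \<union> Z\<close> an independent set of size exactly
  \<open>l + card Z\<close>.\<close>

definition independent_extensions ::
    "('a::field ^ 'n) set \<Rightarrow> ('a ^ 'n) set \<Rightarrow> nat \<Rightarrow> ('a ^ 'n) list set" where
  "independent_extensions Z W l =
     {xs. length xs = l \<and> distinct xs \<and> set xs \<subseteq> W - Z \<and> vec.independent (set xs \<union> Z)}"

lemma finite_independent_extensions:
  "finite (independent_extensions Z (W :: ('a::{field,finite} ^ 'n::finite) set) l)"
  by (rule finite_subset[OF _ finite_lists_length_eq[of UNIV l]])
     (auto simp: independent_extensions_def)

lemma card_Un_independent_extension:
  fixes Z :: "('a::{field,finite} ^ 'n::finite) set"
  assumes "xs \<in> independent_extensions Z W l"
  shows "card (set xs \<union> Z) = l + card Z"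
proof -
  have "set xs \<inter> Z = {}" using assms by (auto simp: independent_extensions_def)
  then show ?thesis
    using assms by (simp add: card_Un_disjoint independent_extensions_def distinct_card)
qed

text \<open>A new vector keeps the set independent iff it avoids the span of the old one; avoiding
  that span also makes it differ from the earlier entries and from \<open>Z\<close>.\<close>

lemma independent_extensions_Suc:
  fixes Z :: "('a::{field,finite} ^ 'n::finite) set"
  shows "independent_extensions Z W (Suc l) =
    (\<lambda>(xs, x). x # xs) `
      (SIGMA xs : independent_extensions Z W l. W - vec.span (set xs \<union> Z))" (is "?L = ?R")
proof (intro Set.set_eqI iffI)
  fix ys assume "ys \<in> ?L"
  then obtain x xs where ys: "ys = x # xs" and *: "length xs = l" "x \<notin> set xs" "distinct xs"
      "x \<in> W" "x \<notin> Z" "set xs \<subseteq> W - Z" "vec.independent (insert x (set xs \<union> Z))"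
    by (cases ys) (auto simp: independent_extensions_def)
  then have "vec.independent (set xs \<union> Z)" "x \<notin> vec.span (set xs \<union> Z)"
    by (auto simp: vec.independent_insert)
  then show "ys \<in> ?R"
    using * ys by (auto simp: independent_extensions_def intro!: image_eqI[where x = "(xs, x)"])
next
  fix ys assume "ys \<in> ?R"
  then obtain x xs where ys: "ys = x # xs" and xs: "xs \<in> independent_extensions Z W l"
    and x: "x \<in> W" "x \<notin> vec.span (set xs \<union> Z)" by auto
  then have "x \<notin> set xs \<union> Z" using vec.span_base by blast
  then show "ys \<in> ?L"
    using xs x ys by (auto simp: independent_extensions_def vec.independent_insert)
qed

text \<open>The vector added at step \<open>i\<close> may be any element of \<open>W\<close> outside
  a span of size \<open>q ^ (card Z + i)\<close>, with \<open>q = CARD('a)\<close>. If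
  \<open>l\<close> exceeds \<open>vec.dim W - card Z\<close>, one factor of the product is zero, as
  it should be.\<close>

lemma card_independent_extensions:
  fixes W :: "('a::{field,finite} ^ 'n::finite) set"
  assumes "vec.subspace W" "Z \<subseteq> W" "vec.independent Z"
  shows "real (card (independent_extensions Z W l)) =
    (\<Prod>i<l. real CARD('a) ^ vec.dim W - real CARD('a) ^ (card Z + i))"
proof (induction l)
  case 0
  have "independent_extensions Z W 0 = {[]}"
    using assms by (auto simp: independent_extensions_def)
  then show ?case by simp
next
  case (Suc l)
  let ?q = "CARD('a)"
  have *: "real (card (W - vec.span (set xs \<union> Z))) = real ?q ^ vec.dim W - real ?q ^ (card Z + l)"
    if xs: "xs \<in> independent_extensions Z W l" for xs
  proof -
    have sub: "vec.span (set xs \<union> Z) \<subseteq> W"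
      using xs assms by (intro vec.span_minimal) (auto simp: independent_extensions_def)
    have "card (vec.span (set xs \<union> Z)) = ?q ^ (card Z + l)"
      using card_span_independent[of "set xs \<union> Z"] xs card_Un_independent_extension[OF xs]
      by (simp add: independent_extensions_def add.commute)
    moreover have "card W = ?q ^ vec.dim W" by (rule card_subspace[OF assms(1)])
    moreover have "real (card (W - vec.span (set xs \<union> Z))) =
        real (card W) - real (card (vec.span (set xs \<union> Z)))"
      using sub by (simp add: card_Diff_subset card_mono of_nat_diff)
    ultimately show ?thesis by simp
  qed
  have "card (independent_extensions Z W (Suc l)) =
      card (SIGMA xs : independent_extensions Z W l. W - vec.span (set xs \<union> Z))"
    unfolding independent_extensions_Suc by (intro card_image) (auto simp: inj_on_def)
  also have "\<dots> = (\<Sum>xs\<in>independent_extensions Z W l. card (W - vec.span (set xs \<union> Z)))"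
    by (simp add: finite_independent_extensions)
  finally have "real (card (independent_extensions Z W (Suc l))) =
      (\<Sum>xs\<in>independent_extensions Z W l. real (card (W - vec.span (set xs \<union> Z))))"
    by simp
  also have "\<dots> = (\<Sum>xs\<in>independent_extensions Z W l.
      real ?q ^ vec.dim W - real ?q ^ (card Z + l))"
    using * by (rule sum.cong[OF refl])
  finally show ?case using Suc by (simp add: mult.commute)
qed

definition subspaces_containing :: "nat \<Rightarrow> ('a::field ^ 'n) set \<Rightarrow> ('a ^ 'n) set set" where
  "subspaces_containing k Z = {V. vec.subspace V \<and> vec.dim V = k \<and> Z \<subseteq> V}"

text \<open>Double counting: an extension of \<open>Z\<close> by \<open>k - card Z\<close> vectors spans exactly one
  \<open>k\<close>-dimensional subspace containing \<open>Z\<close>.\<close>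

lemma card_subspaces_containing:
  fixes Z :: "('a::{field,finite} ^ 'n::finite) set"
  assumes "vec.independent Z" "card Z \<le> k"
  shows "real (card (subspaces_containing k Z)) *
      (\<Prod>i<k - card Z. real CARD('a) ^ k - real CARD('a) ^ (card Z + i)) =
    (\<Prod>i<k - card Z. real CARD('a) ^ CARD('n) - real CARD('a) ^ (card Z + i))"
proof -
  let ?l = "k - card Z"
  \<comment> \<open>An extension determines its subspace, so the families of extensions for
    different \<open>V\<close> are disjoint.\<close>
  have span: "V = vec.span (set xs \<union> Z)"
    if "V \<in> subspaces_containing k Z" "xs \<in> independent_extensions Z V ?l" for V xs
  proof -
    have "vec.span (set xs \<union> Z) \<subseteq> V"
      using that
      by (intro vec.span_minimal) (auto simp: subspaces_containing_def independent_extensions_def)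
    moreover have "vec.dim (vec.span (set xs \<union> Z)) = k"
      using card_Un_independent_extension[OF that(2)] that(2) assms(2)
      by (simp add: vec.dim_span_eq_card_independent independent_extensions_def del: vec.dim_span)
    ultimately show ?thesis
      using that(1) vec.subspace_dim_equal[of "vec.span (set xs \<union> Z)" V]
      by (simp add: subspaces_containing_def)
  qed
  have union: "independent_extensions Z UNIV ?l =
      (\<Union>V\<in>subspaces_containing k Z. independent_extensions Z V ?l)"
  proof (intro Set.set_eqI iffI)
    fix xs :: "('a ^ 'n) list" assume xs: "xs \<in> independent_extensions Z UNIV ?l"
    have "vec.dim (vec.span (set xs \<union> Z)) = k"
      using card_Un_independent_extension[OF xs] xs assms(2)
      by (simp add: vec.dim_span_eq_card_independent independent_extensions_def del: vec.dim_span)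
    then have "vec.span (set xs \<union> Z) \<in> subspaces_containing k Z"
      using vec.span_superset[of "set xs \<union> Z"] by (simp add: subspaces_containing_def)
    moreover have "xs \<in> independent_extensions Z (vec.span (set xs \<union> Z)) ?l"
      using xs vec.span_superset[of "set xs \<union> Z"] by (auto simp: independent_extensions_def)
    ultimately show "xs \<in> (\<Union>V\<in>subspaces_containing k Z. independent_extensions Z V ?l)" by blast
  qed (auto simp: independent_extensions_def)
  have "card (independent_extensions Z UNIV ?l) =
      (\<Sum>V\<in>subspaces_containing k Z. card (independent_extensions Z V ?l))"
    unfolding union
  proof (rule card_UN_disjoint)
    show "\<forall>V\<in>subspaces_containing k Z. \<forall>V'\<in>subspaces_containing k Z. V \<noteq> V' \<longrightarrow>
        independent_extensions Z V ?l \<inter> independent_extensions Z V' ?l = {}"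
      using span by blast
  qed (simp_all add: finite_independent_extensions)
  then have "real (card (independent_extensions Z UNIV ?l)) =
      (\<Sum>V\<in>subspaces_containing k Z. real (card (independent_extensions Z V ?l)))" by simp
  also have "\<dots> = (\<Sum>V\<in>subspaces_containing k Z.
      \<Prod>i<?l. real CARD('a) ^ k - real CARD('a) ^ (card Z + i))"
    by (rule sum.cong)
       (auto simp: card_independent_extensions assms(1) subspaces_containing_def)
  finally show ?thesis
    by (simp add: card_independent_extensions assms(1) vec_dim_card card_cart_basis)
qed

section \<open>Gaussian binomial coefficients as numbers of subspaces\<close>

lemma card_field_ge_2: "2 \<le> CARD('a::{field,finite})"
proof -
  have "card {0, 1 :: 'a} \<le> CARD('a)" by (rule card_mono) auto
  then show ?thesis by simp
qed

lemma gauss_denominator_pos: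
  assumes "q \<ge> 2" shows "(\<Prod>i<k. real q ^ k - real q ^ i) > 0"
  using assms by (intro prod_pos) (auto intro: power_strict_increasing)

lemma card_subspaces:
  assumes "k \<le> CARD('n::finite)"
  shows "real (card (subspaces_containing k ({} :: ('a::{field,finite} ^ 'n) set))) =
    gauss_binomial CARD('a) CARD('n) k"
proof -
  have "(\<Prod>i<k. real CARD('a) ^ k - real CARD('a) ^ i) \<noteq> 0"
    using gauss_denominator_pos[OF card_field_ge_2[where 'a = 'a], of k] by linarith
  then show ?thesis
    using card_subspaces_containing[of "{} :: ('a ^ 'n) set" k] assms
    by (simp add: gauss_binomial_def vec.independent_empty eq_divide_eq)
qed

text \<open>For \<open>Z = {v}\<close> the two products of the double count are the numerator and
  denominator of the Gaussian binomial without their factors at \<open>i = 0\<close>, which are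
  \<open>q ^ n - 1\<close> and \<open>q ^ k - 1\<close>.\<close>

lemma card_subspaces_containing_vector:
  fixes v :: "'a::{field,finite} ^ 'n::finite"
  assumes "v \<noteq> 0" "k \<le> CARD('n)"
  shows "(real CARD('a) ^ CARD('n) - 1) * real (card (subspaces_containing k {v})) =
    (real CARD('a) ^ k - 1) * gauss_binomial CARD('a) CARD('n) k"
proof (cases k)
  case 0
  \<comment> \<open>Here \<open>card {v} > k\<close>, so the general count does not apply; both
    sides of the claim are zero.\<close>
  have "subspaces_containing 0 {v} = {}"
    using assms(1) by (auto simp: subspaces_containing_def vec.dim_eq_0)
  then show ?thesis using 0 by simp
next
  case (Suc l)
  let ?q = "real CARD('a)"
  have eq: "real (card (subspaces_containing k {v})) * (\<Prod>i<l. ?q ^ k - ?q ^ Suc i) =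
      (\<Prod>i<l. ?q ^ CARD('n) - ?q ^ Suc i)"
    using card_subspaces_containing[of "{v}" k] assms Suc
    by (simp add: vec.dependent_single)
  have split: "(\<Prod>i<k. x - ?q ^ i) = (x - 1) * (\<Prod>i<l. x - ?q ^ Suc i)" for x
    unfolding Suc prod.lessThan_Suc_shift by simp
  have "(\<Prod>i<k. ?q ^ k - ?q ^ i) > 0"
    by (rule gauss_denominator_pos[OF card_field_ge_2])
  then have nz: "?q ^ k - 1 \<noteq> 0" "(\<Prod>i<l. ?q ^ k - ?q ^ Suc i) \<noteq> 0"
    unfolding split by (metis less_irrefl mult_zero_left, metis less_irrefl mult_zero_right)
  have "gauss_binomial CARD('a) CARD('n) k =
     (?q ^ CARD('n) - 1) * (\<Prod>i<l. ?q ^ CARD('n) - ?q ^ Suc i) /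
       ((?q ^ k - 1) * (\<Prod>i<l. ?q ^ k - ?q ^ Suc i))"
    using assms(2) unfolding gauss_binomial_def split by simp
  also have "(\<Prod>i<l. ?q ^ CARD('n) - ?q ^ Suc i) =
      real (card (subspaces_containing k {v})) * (\<Prod>i<l. ?q ^ k - ?q ^ Suc i)"
    using eq by simp
  finally have "gauss_binomial CARD('a) CARD('n) k =
      (?q ^ CARD('n) - 1) * real (card (subspaces_containing k {v})) / (?q ^ k - 1)"
    using nz(2) by (simp only: mult.assoc[symmetric] mult_divide_mult_cancel_right
      not_False_eq_True)
  then show ?thesis by (simp only: nonzero_eq_divide_eq[OF nz(1)] mult.commute)
qed

text \<open>Over the common denominator, both sides equal the product of
  \<open>q ^ n - q ^ i\<close> over \<open>i \<le> k\<close>: the left side splits off the last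
  factor, the right side the first one and then a \<open>q\<close> from each of the others. For
  \<open>k = n\<close> both sides vanish.\<close>

lemma gauss_binomial_pred:
  assumes "q \<ge> 2" "n \<ge> 1" "k \<le> n"
  shows "(real q ^ n - real q ^ k) * gauss_binomial q n k =
    real q ^ k * (real q ^ n - 1) * gauss_binomial q (n - 1) k"
proof (cases "k = n")
  case False
  obtain m where n: "n = Suc m" using assms(2) by (cases n) auto
  let ?q = "real q"
  have "(?q ^ n - ?q ^ k) * (\<Prod>i<k. ?q ^ n - ?q ^ i) = (\<Prod>i<Suc k. ?q ^ n - ?q ^ i)"
    by simp
  also have "\<dots> = (?q ^ n - 1) * (\<Prod>i<k. ?q * (?q ^ m - ?q ^ i))"
    unfolding prod.lessThan_Suc_shift by (simp add: n right_diff_distrib)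
  also have "\<dots> = (?q ^ n - 1) * (?q ^ k * (\<Prod>i<k. ?q ^ m - ?q ^ i))"
    by (simp add: prod.distrib)
  finally show ?thesis using assms False by (simp add: gauss_binomial_def n)
qed (use assms in \<open>simp add: gauss_binomial_def\<close>)

section \<open>Affine planes\<close>

text \<open>Any point of a coset can serve as its base point: the shift from \<open>z\<close> to
  \<open>x\<close> lies in \<open>V\<close> and is absorbed there.\<close>

lemma affine_plane_through:
  fixes x :: "'a::field ^ 'n::finite"
  assumes "A \<in> affine_planes k" "x \<in> A"
  obtains V where "vec.subspace V" "vec.dim V = k" "A = (\<lambda>v. x + v) ` V"
proof -
  obtain z V where A: "A = (\<lambda>v. z + v) ` V" and V: "vec.subspace V" "vec.dim V = k"
    using assms(1) by (auto simp: affine_planes_def)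
  obtain v where v: "v \<in> V" "x = z + v" using assms(2) A by auto
  have "A = (\<lambda>v. x + v) ` V"
  proof (intro Set.set_eqI iffI)
    fix y assume "y \<in> A"
    then obtain w where "w \<in> V" "y = z + w" using A by auto
    then show "y \<in> (\<lambda>v. x + v) ` V"
      using v V by (intro image_eqI[where x = "w - v"]) (auto intro: vec.subspace_diff)
  next
    fix y assume "y \<in> (\<lambda>v. x + v) ` V"
    then obtain w where "w \<in> V" "y = x + w" by auto
    then show "y \<in> A" unfolding A
      using v V by (intro image_eqI[where x = "v + w"]) (auto intro: vec.subspace_add)
  qed
  then show ?thesis using that V by blast
qed

lemma card_affine_plane:
  assumes "A \<in> affine_planes k"
  shows "card (A :: ('a::{field,finite} ^ 'n::finite) set) = CARD('a) ^ k"
  using assms card_subspace by (auto simp: affine_planes_def card_image)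

text \<open>Translation by \<open>- x\<close> turns the planes through \<open>x\<close> and
  \<open>y\<close> into the subspaces containing \<open>y - x\<close>. For \<open>x = y\<close> this
  vector is zero, and all \<open>k\<close>-dimensional subspaces are counted.\<close>

lemma card_affine_planes_through:
  fixes x y :: "'a::field ^ 'n::finite"
  shows "card {A \<in> affine_planes k. x \<in> A \<and> y \<in> A} = card (subspaces_containing k {y - x})"
proof -
  have "bij_betw (\<lambda>V. (\<lambda>v. x + v) ` V) (subspaces_containing k {y - x})
      {A \<in> affine_planes k. x \<in> A \<and> y \<in> A}"
    unfolding bij_betw_def
  proof
    show "inj_on (\<lambda>V. (\<lambda>v. x + v) ` V) (subspaces_containing k {y - x})"
      by (simp add: inj_on_def inj_image_eq_iff)
    show "(\<lambda>V. (\<lambda>v. x + v) ` V) ` subspaces_containing k {y - x} =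
        {A \<in> affine_planes k. x \<in> A \<and> y \<in> A}" (is "?L = ?R")
    proof (intro Set.set_eqI iffI)
      fix A assume "A \<in> ?L"
      then obtain V where V: "vec.subspace V" "vec.dim V = k" "y - x \<in> V" "A = (\<lambda>v. x + v) ` V"
        by (auto simp: subspaces_containing_def)
      have "x \<in> A" using V by (auto intro: image_eqI[where x = 0] vec.subspace_0)
      moreover have "y \<in> A" using V by (auto intro: image_eqI[where x = "y - x"])
      ultimately show "A \<in> ?R" using V by (auto simp: affine_planes_def)
    next
      fix A assume A: "A \<in> ?R"
      then obtain V where V: "vec.subspace V" "vec.dim V = k" "A = (\<lambda>v. x + v) ` V"
        using affine_plane_through by blast
      then have "y - x \<in> V" using A by auto
      then show "A \<in> ?L" using V by (auto simp: subspaces_containing_def)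
    qed
  qed
  then show ?thesis by (simp add: bij_betw_same_card)
qed

section \<open>Moments of the intersection sizes by double counting\<close>

lemma sum_card_Int_eq:
  assumes "finite E" "finite \<P>"
  shows "(\<Sum>A\<in>\<P>. card (E \<inter> A)) = (\<Sum>x\<in>E. card {A \<in> \<P>. x \<in> A})"
proof -
  have "card (E \<inter> A) = (\<Sum>x\<in>E. of_bool (x \<in> A))" for A
    using assms(1) by simp
  moreover have "card {A \<in> \<P>. x \<in> A} = (\<Sum>A\<in>\<P>. of_bool (x \<in> A))" for x
    using assms(2) by (simp add: Collect_conj_eq)
  ultimately show ?thesis by (simp only: sum.swap[of _ E \<P>])
qed

lemma sum_card_Int_square_eq:
  assumes "finite E" "finite \<P>"
  shows "(\<Sum>A\<in>\<P>. (card (E \<inter> A))\<^sup>2) = (\<Sum>x\<in>E. \<Sum>y\<in>E. card {A \<in> \<P>. x \<in> A \<and> y \<in> A})"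
proof -
  have "(card (E \<inter> A))\<^sup>2 = (\<Sum>x\<in>E. if x \<in> A then card (E \<inter> A) else 0)" for A
    using assms(1) by (simp add: power2_eq_square flip: sum.inter_restrict)
  then have "(\<Sum>A\<in>\<P>. (card (E \<inter> A))\<^sup>2) =
      (\<Sum>x\<in>E. \<Sum>A\<in>\<P>. if x \<in> A then card (E \<inter> A) else 0)"
    by (simp only: sum.swap[of _ E \<P>])
  also have "\<dots> = (\<Sum>x\<in>E. \<Sum>A\<in>{A \<in> \<P>. x \<in> A}. card (E \<inter> A))"
    by (simp only: sum.inter_filter[OF assms(2)])
  \<comment> \<open>For each \<open>x\<close>, the first-moment identity is applied to the subfamily
    of sets through \<open>x\<close>.\<close>
  also have "\<dots> = (\<Sum>x\<in>E. \<Sum>y\<in>E. card {A \<in> {A \<in> \<P>. x \<in> A}. y \<in> A})"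
    using assms by (intro sum.cong refl sum_card_Int_eq) auto
  finally show ?thesis by (simp only: mem_Collect_eq conj_assoc)
qed

lemma card_affine_planes_containing_point:
  fixes x :: "'a::{field,finite} ^ 'n::finite"
  assumes "k \<le> CARD('n)"
  shows "real (card {A \<in> affine_planes k. x \<in> A}) = gauss_binomial CARD('a) CARD('n) k"
proof -
  have "subspaces_containing k {0} = subspaces_containing k ({} :: ('a ^ 'n) set)"
    by (auto simp: subspaces_containing_def vec.subspace_0)
  then show ?thesis
    using card_affine_planes_through[of k x x] card_subspaces[OF assms, where 'a = 'a] by simp
qed

text \<open>The first moment for the whole space: each plane has \<open>q ^ k\<close> points, and
  the same number of planes passes through each point.\<close>

lemma card_affine_planes:
  assumes "k \<le> CARD('n::finite)"
  shows "real (card (affine_planes k :: ('a::{field,finite} ^ 'n) set set)) * real CARD('a) ^ k =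
    real CARD('a) ^ CARD('n) * gauss_binomial CARD('a) CARD('n) k"
proof -
  let ?P = "affine_planes k :: ('a ^ 'n) set set"
  have "real (\<Sum>A\<in>?P. card (UNIV \<inter> A)) =
      (\<Sum>x\<in>(UNIV :: ('a ^ 'n) set). real (card {A \<in> ?P. x \<in> A}))"
    by (subst sum_card_Int_eq) auto
  then show ?thesis
    by (simp add: card_affine_plane card_affine_planes_containing_point[OF assms])
qed

text \<open>The \<open>e\<close> diagonal pairs of points contribute \<open>B\<close> each; the
  \<open>e * (e - 1)\<close> pairs of distinct points contribute the number of
  \<open>k\<close>-dimensional subspaces through a fixed nonzero vector.\<close>

lemma sum_card_Int_affine_planes_square:
  fixes E :: "('a::{field,finite} ^ 'n::finite) set"
  assumes "k \<le> CARD('n)"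
  defines "q \<equiv> real CARD('a)" and "e \<equiv> real (card E)"
  defines "B \<equiv> gauss_binomial CARD('a) CARD('n) k"
  shows "(\<Sum>A\<in>affine_planes k. (real (card (E \<inter> A)))\<^sup>2) =
    e * B + e * (e - 1) * ((q ^ k - 1) * B / (q ^ CARD('n) - 1))"
proof -
  let ?P = "affine_planes k :: ('a ^ 'n) set set"
  let ?D = "(q ^ k - 1) * B / (q ^ CARD('n) - 1)"
  have "q ^ CARD('n) > 1"
    using card_field_ge_2[where 'a = 'a] by (intro one_less_power) (auto simp: q_def)
  then have nz: "q ^ CARD('n) - 1 \<noteq> 0" by linarith
  have D: "real (card {A \<in> ?P. x \<in> A \<and> y \<in> A}) = ?D" if "x \<noteq> y" for x y
    unfolding card_affine_planes_through nonzero_eq_divide_eq[OF nz] mult.commute[of _ "_ - 1"]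
    unfolding q_def B_def using that assms(1) by (intro card_subspaces_containing_vector) auto
  have "(\<Sum>A\<in>?P. (real (card (E \<inter> A)))\<^sup>2) = real (\<Sum>A\<in>?P. (card (E \<inter> A))\<^sup>2)"
    by (simp only: of_nat_sum of_nat_power)
  also have "\<dots> = (\<Sum>x\<in>E. \<Sum>y\<in>E. real (card {A \<in> ?P. x \<in> A \<and> y \<in> A}))"
    by (subst sum_card_Int_square_eq) auto
  also have "\<dots> = (\<Sum>x\<in>E. B + (e - 1) * ?D)"
  proof (rule sum.cong[OF refl])
    fix x assume x: "x \<in> E"
    have "(\<Sum>y\<in>E. real (card {A \<in> ?P. x \<in> A \<and> y \<in> A})) =
        real (card {A \<in> ?P. x \<in> A}) + (\<Sum>y\<in>E - {x}. real (card {A \<in> ?P. x \<in> A \<and> y \<in> A}))"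
      using x by (subst sum.remove[of E x]) auto
    also have "(\<Sum>y\<in>E - {x}. real (card {A \<in> ?P. x \<in> A \<and> y \<in> A})) = (\<Sum>y\<in>E - {x}. ?D)"
      using D by (intro sum.cong) auto
    also have "\<dots> = (e - 1) * ?D"
    proof -
      have "card E \<ge> 1" using x by (auto simp: Suc_le_eq card_gt_0_iff)
      then have "real (card (E - {x})) = e - 1" using x by (simp add: e_def of_nat_diff)
      then show ?thesis by (simp only: sum_constant)
    qed
    finally show "(\<Sum>y\<in>E. real (card {A \<in> ?P. x \<in> A \<and> y \<in> A})) = B + (e - 1) * ?D"
      using card_affine_planes_containing_point[OF assms(1)] by (simp add: B_def)
  qed
  finally show ?thesis by (simp only: sum_constant e_def[symmetric] distrib_left mult.assoc)
qed

text \<open>The subtracted quotient is the average of \<open>card (E \<inter> A)\<close> over all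
  \<open>k\<close>-planes, so this is an unnormalised variance. It follows from the moments
  \<open>s0\<close>, \<open>s1\<close>, \<open>s2\<close> by expanding the square.\<close>

lemma sum_affine_planes_deviation_square:
  fixes E :: "('a::{field,finite} ^ 'n::finite) set"
  assumes k: "k \<le> CARD('n)"
  defines "q \<equiv> CARD('a)" and "n \<equiv> CARD('n)"
  shows "(\<Sum>A\<in>affine_planes k. (real (card (E \<inter> A)) - real (card E) / real q ^ (n - k))\<^sup>2) =
    real (card E) * real q ^ k * gauss_binomial q (n - 1) k * (1 - real (card E) / real q ^ n)"
proof -
  let ?P = "affine_planes k :: ('a ^ 'n) set set"
  \<comment> \<open>With the powers abstracted, the identity becomes one between rational functions
    of \<open>e\<close>, \<open>Q\<close>, \<open>K\<close> and \<open>B\<close>.\<close>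
  define e Q K B where "e = real (card E)" and "Q = real q ^ n" and "K = real q ^ k"
    and "B = gauss_binomial q n k"
  have q: "q \<ge> 2" and n: "n \<ge> 1"
    using card_field_ge_2 by (simp_all add: q_def n_def Suc_le_eq)
  have pos: "Q > 1" "K > 0"
    using q n unfolding Q_def K_def by (auto intro!: one_less_power)
  have quot: "real (card E) / real q ^ (n - k) = e * K / Q"
    using q k by (simp add: e_def K_def Q_def n_def power_diff)
  have s0: "real (card ?P) = Q * B / K"
    using card_affine_planes[OF k, where 'a = 'a] pos
    by (simp add: q_def n_def Q_def K_def B_def eq_divide_eq)
  have "(\<Sum>A\<in>?P. real (card (E \<inter> A))) = real (\<Sum>A\<in>?P. card (E \<inter> A))" by simp
  also have "\<dots> = (\<Sum>x\<in>E. real (card {A \<in> ?P. x \<in> A}))" by (subst sum_card_Int_eq) auto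
  finally have s1: "(\<Sum>A\<in>?P. real (card (E \<inter> A))) = e * B"
    by (simp add: card_affine_planes_containing_point[OF k] e_def B_def q_def n_def)
  have s2: "(\<Sum>A\<in>?P. (real (card (E \<inter> A)))\<^sup>2) = e * B + e * (e - 1) * ((K - 1) * B / (Q - 1))"
    using sum_card_Int_affine_planes_square[OF k, of E]
    by (simp add: e_def B_def q_def n_def Q_def K_def)
  \<comment> \<open>This converts the coefficient produced by the expansion into the binomial with
    upper index \<open>n - 1\<close> of the bound.\<close>
  have C: "K * gauss_binomial q (n - 1) k = (Q - K) * B / (Q - 1)"
    using gauss_binomial_pred[OF q n, of k] k pos
    by (simp add: Q_def K_def B_def n_def eq_divide_eq mult_ac)
  have "(\<Sum>A\<in>?P. (real (card (E \<inter> A)) - e * K / Q)\<^sup>2) =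
      (\<Sum>A\<in>?P. (real (card (E \<inter> A)))\<^sup>2) - 2 * (e * K / Q) * (\<Sum>A\<in>?P. real (card (E \<inter> A)))
        + real (card ?P) * (e * K / Q)\<^sup>2"
    by (simp add: power2_diff sum.distrib sum_subtractf sum_distrib_left sum_divide_distrib mult_ac)
  also have "\<dots> = e * ((Q - K) * B / (Q - 1)) * (1 - e / Q)"
  proof -
    have "Q - 1 \<noteq> 0" "Q \<noteq> 0" "K \<noteq> 0" using pos by auto
    then show ?thesis unfolding s0 s1 s2 by (simp add: field_simps power2_eq_square)
  qed
  finally show ?thesis unfolding quot C[symmetric] by (simp add: e_def Q_def K_def mult_ac)
qed

lemma incidences_eq_sum:
  assumes "finite E" "finite \<A>"
  shows "incidences E \<A> = (\<Sum>A\<in>\<A>. card (E \<inter> A))"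
proof -
  have "{(p, A). p \<in> E \<and> A \<in> \<A> \<and> p \<in> A} = prod.swap ` (SIGMA A : \<A>. E \<inter> A)" by force
  then show ?thesis using assms by (simp add: incidences_def card_image)
qed

section \<open>The bounding fraction\<close>

text \<open>Since \<open>k * (n - k) = k + k * (n - k - 1)\<close> over the integers, the
  denominator cancels and leaves \<open>q ^ k\<close>. This matches the exact second moment with the
  two factors of the bound.\<close>

lemma mult_bound_fraction:
  assumes "q \<ge> 2" "n \<ge> 1" "k \<le> n"
  shows "real q ^ (k * (n - k)) * bound_fraction q n k m =
    real q ^ k * gauss_binomial q (n - 1) k * (1 - real m / real q ^ n)"
proof -
  have "int (k * (n - k)) = int k + int k * (int n - int k - 1)"
    using assms(3) by (simp add: of_nat_diff algebra_simps)
  then have "real q powi int (k * (n - k)) =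
      real q ^ k * real q powi (int k * (int n - int k - 1))"
    using assms(1) by (simp add: power_int_add)
  then have "real q ^ (k * (n - k)) = real q ^ k * real q powi (int k * (int n - int k - 1))"
    by (simp only: power_int_of_nat)
  then show ?thesis
    using assms(1) by (simp add: bound_fraction_def power_int_minus field_simps)
qed

text \<open>Each of the \<open>k\<close> factors of the Gaussian binomial is at most
  \<open>q ^ (n - 1 - k) * (q / (q - 1))\<close>, and the factor depending on \<open>m\<close> lies
  between 0 and 1. For \<open>k = n\<close> or larger the binomial is zero.\<close>

lemma bound_fraction_le:
  assumes q: "q \<ge> 2" and n: "n \<ge> 1" and m: "m \<le> q ^ n"
  shows "bound_fraction q n k m \<le> (real q / (real q - 1)) ^ k"
proof (cases "k \<le> n - 1")
  case True
  have "gauss_binomial q (n - 1) k =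
      (\<Prod>i<k. (real q ^ (n - 1) - real q ^ i) / (real q ^ k - real q ^ i))"
    using True by (simp add: gauss_binomial_def prod_dividef)
  also have "\<dots> \<le> (\<Prod>i<k. real q ^ (n - 1 - k) * (real q / (real q - 1)))"
  proof (rule prod_mono)
    fix i assume "i \<in> {..<k}"
    then have i: "i < k" by simp
    \<comment> \<open>The index \<open>l = k - 1\<close> is the largest one and gives the smallest
      denominator.\<close>
    then obtain l where k: "k = Suc l" by (cases k) auto
    have le: "real q ^ i \<le> real q ^ l" "real q ^ i \<le> real q ^ (n - 1)"
      using i k q True by (auto intro!: power_increasing)
    have pos: "real q ^ k - real q ^ l > 0"
      using q k by (auto intro: power_strict_increasing)
    have "(real q ^ (n - 1) - real q ^ i) / (real q ^ k - real q ^ i) \<le>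
        real q ^ (n - 1) / (real q ^ k - real q ^ l)"
      using le pos by (intro frac_le) auto
    also have "\<dots> = real q ^ (n - 1 - k) * (real q / (real q - 1))"
    proof -
      have "real q ^ (n - 1) = real q ^ (n - 1 - k) * real q ^ k"
        using True by (simp only: le_add_diff_inverse2 flip: power_add)
      moreover have "real q ^ k - real q ^ l = real q ^ l * (real q - 1)"
        by (simp add: k algebra_simps)
      ultimately show ?thesis using q by (simp add: k)
    qed
    finally show "0 \<le> (real q ^ (n - 1) - real q ^ i) / (real q ^ k - real q ^ i) \<and>
        (real q ^ (n - 1) - real q ^ i) / (real q ^ k - real q ^ i) \<le>
          real q ^ (n - 1 - k) * (real q / (real q - 1))"
      using le pos by auto
  qed
  also have "\<dots> = real q ^ (k * (n - 1 - k)) * (real q / (real q - 1)) ^ k"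
    by (simp only: prod_constant card_lessThan power_mult_distrib mult.commute[of k]
        flip: power_mult)
  finally have gauss: "gauss_binomial q (n - 1) k \<le>
      real q ^ (k * (n - 1 - k)) * (real q / (real q - 1)) ^ k" .
  \<comment> \<open>In this case the integer exponent is nonnegative, so \<open>powi\<close> becomes
    an ordinary power.\<close>
  have "int n - int k - 1 = int (n - 1 - k)"
    using True n by arith
  then have "int k * (int n - int k - 1) = int (k * (n - 1 - k))"
    by (simp only: of_nat_mult)
  then have "bound_fraction q n k m = gauss_binomial q (n - 1) k * (1 - real m / real q ^ n)
      / real q ^ (k * (n - 1 - k))"
    unfolding bound_fraction_def
    by (simp only: power_int_of_nat power_int_minus divide_inverse mult.commute)
  also have "\<dots> \<le> real q ^ (k * (n - 1 - k)) * (real q / (real q - 1)) ^ k * 1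
      / real q ^ (k * (n - 1 - k))"
  proof (intro divide_right_mono mult_mono gauss)
    have "real m \<le> real q ^ n" using m by (simp flip: of_nat_power)
    then show "0 \<le> 1 - real m / real q ^ n" using q by simp
  qed (use q in auto)
  finally show ?thesis using q by simp
qed (use q in \<open>simp add: bound_fraction_def gauss_binomial_def\<close>)

lemma tendsto_quotient_pred_power:
  "(\<lambda>q. (real q / (real q - 1)) ^ k) \<longlonglongrightarrow> 1"
proof -
  have "(\<lambda>q. real q / (real q - 1)) \<longlonglongrightarrow> 1" by real_asymp
  from tendsto_power[OF this, of k] show ?thesis by simp
qed

section \<open>The incidence bound and the uniform asymptotics of its fraction\<close>

theorem theorem8p5:
  fixes q n k :: nat
  assumes "CARD('a::{field,finite}) = q" and "CARD('n::finite) = n" and "k \<le> n"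
  shows
    "(\<forall>(E :: ('a ^ 'n) set) \<A>. \<A> \<subseteq> affine_planes k \<longrightarrow>
        \<bar>real (incidences E \<A>) - real (card E) * real (card \<A>) / real q ^ (n - k)\<bar>
          \<le> sqrt (real q ^ (k * (n - k)) * real (card E) * real (card \<A>))
             * sqrt (bound_fraction q n k (card E)))
     \<and> (\<exists>\<epsilon> :: nat \<Rightarrow> real. \<epsilon> \<in> o(\<lambda>_. 1) \<and>
          (\<forall>r m. primepow r \<longrightarrow> m \<le> r ^ n \<longrightarrow> bound_fraction r n k m \<le> 1 + \<epsilon> r))"
proof (intro conjI allI impI)
  have q: "q \<ge> 2" and n: "n \<ge> 1"
    using card_field_ge_2[where 'a = 'a] assms by (simp_all add: Suc_le_eq flip: assms(2))
  {
    fix E :: "('a ^ 'n) set" and \<A> :: "('a ^ 'n) set set"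
    assume sub: "\<A> \<subseteq> affine_planes k"
    let ?d = "\<lambda>A. real (card (E \<inter> A)) - real (card E) / real q ^ (n - k)"
    have "real (incidences E \<A>) - real (card E) * real (card \<A>) / real q ^ (n - k) = (\<Sum>A\<in>\<A>. ?d A)"
      by (simp add: incidences_eq_sum sum_subtractf)
    \<comment> \<open>Cauchy--Schwarz against the constant function 1.\<close>
    moreover have "(\<Sum>A\<in>\<A>. ?d A)\<^sup>2 \<le> real (card \<A>) * (\<Sum>A\<in>\<A>. (?d A)\<^sup>2)"
      using Cauchy_Schwarz_ineq_sum[of "\<lambda>_. 1" ?d \<A>] by simp
    \<comment> \<open>The added terms are squares; passing to all planes makes the exact second
      moment available.\<close>
    moreover have "(\<Sum>A\<in>\<A>. (?d A)\<^sup>2) \<le> (\<Sum>A\<in>affine_planes k. (?d A)\<^sup>2)"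
      by (rule sum_mono2) (use sub in auto)
    moreover have "(\<Sum>A\<in>affine_planes k. (?d A)\<^sup>2) =
        real (card E) * (real q ^ (k * (n - k)) * bound_fraction q n k (card E))"
      using sum_affine_planes_deviation_square[of k E] assms mult_bound_fraction[OF q n]
      by (simp add: mult_ac)
    ultimately have
      "(real (incidences E \<A>) - real (card E) * real (card \<A>) / real q ^ (n - k))\<^sup>2 \<le>
        real q ^ (k * (n - k)) * real (card E) * real (card \<A>) * bound_fraction q n k (card E)"
      using mult_left_mono[of "\<Sum>A\<in>\<A>. (?d A)\<^sup>2" "\<Sum>A\<in>affine_planes k. (?d A)\<^sup>2" "real (card \<A>)"]
      by (simp add: mult_ac)
    then show "\<bar>real (incidences E \<A>) - real (card E) * real (card \<A>) / real q ^ (n - k)\<bar>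
          \<le> sqrt (real q ^ (k * (n - k)) * real (card E) * real (card \<A>))
             * sqrt (bound_fraction q n k (card E))"
      \<comment> \<open>\<open>sqrt\<close> is multiplicative on all reals, so the two roots merge
        whatever the signs of their arguments.\<close>
      unfolding real_sqrt_mult[symmetric]
      by (rule real_le_rsqrt[OF order.trans[OF eq_refl[OF power2_abs]]])
  }
  show "\<exists>\<epsilon> :: nat \<Rightarrow> real. \<epsilon> \<in> o(\<lambda>_. 1) \<and>
      (\<forall>r m. primepow r \<longrightarrow> m \<le> r ^ n \<longrightarrow> bound_fraction r n k m \<le> 1 + \<epsilon> r)"
  \<comment> \<open>The witness is the excess over 1 of the bound in
    \<open>bound_fraction_le\<close>. It depends only on \<open>r\<close> and \<open>k\<close>,
    which gives uniformity in \<open>m\<close>.\<close>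
  proof (intro exI[where x = "\<lambda>r. (real r / (real r - 1)) ^ k - 1"] conjI allI impI)
    have "(\<lambda>r. (real r / (real r - 1)) ^ k - 1) \<longlonglongrightarrow> 0"
      using tendsto_diff[OF tendsto_quotient_pred_power tendsto_const[of 1]] by simp
    then show "(\<lambda>r. (real r / (real r - 1)) ^ k - 1) \<in> o(\<lambda>_. 1)"
      by (intro smalloI_tendsto) simp_all
    fix r m :: nat
    assume "primepow r" "m \<le> r ^ n"
    moreover have "r \<ge> 2" using primepow_gt_Suc_0[OF \<open>primepow r\<close>] by simp
    ultimately show "bound_fraction r n k m \<le> 1 + ((real r / (real r - 1)) ^ k - 1)"
      using bound_fraction_le[of r n m k] n by simp
  qed
qed

end
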